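(* Let $I$ be any instance of the full-information contextual blocking bandits problem, with maximum delay $d_{\max}=\max_{i\in\mathcal A} d_i$, and let $\pi$ denote the algorithm FI-CBB. For every time horizon $T\in\mathbb N_+$, the competitive ratio of FI-CBB against an optimal clairvoyant algorithm is at least $\frac{d_{\max}}{2d_{\max}-1}\left(1-\frac{d_{\max}-1}{d_{\max}-1+T}\right)$, i.e. $$\mathbf{Rew}^{\pi}_I(T)\;\ge\;\frac{d_{\max}}{2d_{\max}-1}\left(1-\frac{d_{\max}-1}{d_{\max}-1+T}\right)\mathbf{Rew}^{*}_I(T).$$
   Context: Instance. $\mathcal A$ is a finite set of $k\ge1$ arms, $\mathcal C$ a finite set of $m\ge1$ contexts. In each round $t=1,2,\dots,T$ a context $C_t\in\mathcal C$ is drawn independently, $C_t=j$ with probability $f_j>0$, $\sum_{j}f_j=1$. The player observes $C_t$ and then plays at most one available arm. If arm $i$ is played at round $t$ under context $j$ the player receives reward $X_{i,j,t}$; for each $(i,j)$ the variables $X_{i,j,t}$ are i.i.d. over $t$ with values in $[0,1]$ and mean $\mu_{i,j}$, and rewards are independent of contexts and of the player's randomness. Each arm $i$ has a delay $d_i\in\mathbb N$, $d_i\ge1$: if $i$ is played at round $t$ it is unavailable during the next $d_i-1$ rounds, i.e. it can be played again from round $t+d_i$ on. All arms are available at round 1. In the full-information problem the player knows $\{f_j\},\{d_i\},\{\mu_{i,j}\}$ (but not $T$). Rewards. For an algorithm $\pi$ playing arm $A^\pi_t\in\mathcal A\cup\{\emptyset\}$ at round $t$, $\mathbf{Rew}^\pi_I(T)=\mathbb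 E\big[\sum_{t=1}^T\sum_{i,j}X_{i,j,t}\,\mathbb I(A^\pi_t=i,C_t=j)\big]$, the expectation being over contexts, rewards and the algorithm's random bits. $\mathbf{Rew}^*_I(T)$ is the expected reward of an optimal clairvoyant algorithm, which knows the realizations of the contexts of all rounds $1,\dots,T$ in advance (but not the reward realizations); equivalently, it is the expectation over the context sequence of the maximum, over feasible schedules $(A_t)_{t\le T}$ (respecting the delays), of $\sum_{t:A_t\ne\emptyset}\mu_{A_t,C_t}$. Linear program (LP): maximize $\sum_{i\in\mathcal A}\sum_{j\in\mathcal C}\mu_{i,j}z_{i,j}$ subject to $\sum_{j}z_{i,j}\le 1/d_i$ for all $i$, $\sum_i z_{i,j}\le f_j$ for all $j$, $z_{i,j}\ge0$. Algorithm FI-CBB. Compute an optimal solution $\{z^*_{i,j}\}$ of (LP). Define recursively, for each arm $i$, $q_{i,1}=1$, $\beta_{i,t}=\min\{1,\frac{d_i}{2d_i-1}\frac1{q_{i,t}}\}$, and $$q_{i,t+1}=q_{i,t}\Big(1-\beta_{i,t}\sum_j z^*_{i,j}\Big)+\mathbb I(t\ge d_i)\,q_{i,t-d_i+1}\,\beta_{i,t-d_i+1}\sum_j z^*_{i,j}.$$ At each round $t$: observe the context $j_t$; sample at most one arm, arm $i$ being sampled with probability $z^*_{i,j_t}/f_{j_t}$ (no arm with the remaining probability), independently of everything else and regardless of availability. If an arm $i_t$ is sampled and it is available, play it with probability $\beta_{i_t,t}$ (independent coin); in all other cases play nothing in this round. *)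

theory Defs
  imports "HOL-Probability.Probability"
begin

text \<open>
  Contextual blocking bandits.  Arms form a finite type \<open>'a\<close>, contexts a finite type \<open>'c\<close>,
  rounds are numbered from \<open>1\<close>.  The context law is \<open>f :: 'c pmf\<close>, delays are
  \<open>d :: 'a \<Rightarrow> nat\<close>, mean rewards \<open>\<mu> :: 'a \<Rightarrow> 'c \<Rightarrow> real\<close>.  In a schedule
  \<open>A :: nat \<Rightarrow> 'a option\<close> the value \<^const>\<open>None\<close> means that no arm is played.
\<close>

definition available :: "('a \<Rightarrow> nat) \<Rightarrow> (nat \<Rightarrow> 'a option) \<Rightarrow> 'a \<Rightarrow> nat \<Rightarrow> bool" where
  "available d A i t \<longleftrightarrow> (\<forall>s\<in>{1..<t}. A s = Some i \<longrightarrow> s + d i \<le> t)"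

definition feasible_schedules :: "('a \<Rightarrow> nat) \<Rightarrow> nat \<Rightarrow> (nat \<Rightarrow> 'a option) set" where
  "feasible_schedules d T =
     {A \<in> {1..T} \<rightarrow>\<^sub>E UNIV. \<forall>t\<in>{1..T}. \<forall>i. A t = Some i \<longrightarrow> available d A i t}"

text \<open>Only the rounds \<open>1..T\<close> of a context sequence are meaningful.\<close>

definition context_law :: "'c pmf \<Rightarrow> nat \<Rightarrow> (nat \<Rightarrow> 'c) pmf" where
  "context_law f T = Pi_pmf {1..T} undefined (\<lambda>_. f)"

text \<open>
  The reward \<open>X i j t\<close> of playing arm \<open>i\<close> under context \<open>j\<close> at round \<open>t\<close> is a random variable on
  a space \<open>N\<close>.  The law \<open>R\<close> of contexts and plays is combined with \<open>N\<close> by a product measure: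
  this expresses that the rewards are independent of the contexts and of the random bits of an
  algorithm that does not look at the rewards.
\<close>

definition expected_reward ::
  "'w measure \<Rightarrow> ('a::finite \<Rightarrow> 'c::finite \<Rightarrow> nat \<Rightarrow> 'w \<Rightarrow> real) \<Rightarrow> nat \<Rightarrow>
   ((nat \<Rightarrow> 'c) \<times> (nat \<Rightarrow> 'a option)) pmf \<Rightarrow> real" where
  "expected_reward N X T R =
     (\<integral>((c, A), w). (\<Sum>t=1..T. \<Sum>i\<in>UNIV. \<Sum>j\<in>UNIV.
         X i j t w * of_bool (A t = Some i \<and> c t = j)) \<partial>(measure_pmf R \<Otimes>\<^sub>M N))"

definition schedule_value ::
  "('a \<Rightarrow> 'c \<Rightarrow> real) \<Rightarrow> nat \<Rightarrow> (nat \<Rightarrow> 'c) \<Rightarrow> (nat \<Rightarrow> 'a option) \<Rightarrow> real" where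
  "schedule_value \<mu> T c A =
     (\<Sum>t=1..T. case A t of None \<Rightarrow> 0 | Some i \<Rightarrow> \<mu> i (c t))"

text \<open>
  Not knowing the reward realizations, an optimal clairvoyant algorithm plays, for every context
  sequence, a feasible schedule of maximal total mean reward.
\<close>

definition clairvoyant_reward ::
  "'c pmf \<Rightarrow> ('a::finite \<Rightarrow> nat) \<Rightarrow> ('a \<Rightarrow> 'c \<Rightarrow> real) \<Rightarrow> nat \<Rightarrow> real" where
  "clairvoyant_reward f d \<mu> T =
     measure_pmf.expectation (context_law f T)
       (\<lambda>c. Max (schedule_value \<mu> T c ` feasible_schedules d T))"

definition lp_feasible ::
  "'c pmf \<Rightarrow> ('a::finite \<Rightarrow> nat) \<Rightarrow> ('a \<Rightarrow> 'c::finite \<Rightarrow> real) \<Rightarrow> bool" where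
  "lp_feasible f d z \<longleftrightarrow>
     (\<forall>i. (\<Sum>j\<in>UNIV. z i j) \<le> 1 / real (d i)) \<and>
     (\<forall>j. (\<Sum>i\<in>UNIV. z i j) \<le> pmf f j) \<and>
     (\<forall>i j. 0 \<le> z i j)"

definition lp_value ::
  "('a::finite \<Rightarrow> 'c::finite \<Rightarrow> real) \<Rightarrow> ('a \<Rightarrow> 'c \<Rightarrow> real) \<Rightarrow> real" where
  "lp_value \<mu> z = (\<Sum>i\<in>UNIV. \<Sum>j\<in>UNIV. \<mu> i j * z i j)"

definition lp_optimal ::
  "'c pmf \<Rightarrow> ('a::finite \<Rightarrow> nat) \<Rightarrow> ('a \<Rightarrow> 'c::finite \<Rightarrow> real) \<Rightarrow> ('a \<Rightarrow> 'c \<Rightarrow> real) \<Rightarrow> bool" where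
  "lp_optimal f d \<mu> z \<longleftrightarrow>
     lp_feasible f d z \<and> (\<forall>z'. lp_feasible f d z' \<longrightarrow> lp_value \<mu> z' \<le> lp_value \<mu> z)"

text \<open>
  For \<open>r = 0\<close> the minimum should be \<open>1\<close>, whereas here \<open>1 / 0 = 0\<close>.  This is never relevant for
  the algorithm: if \<open>z\<close> is feasible for the linear program, then
  \<open>avail_q d z i t \<ge> d i / (2 * d i - 1) > 0\<close>.
\<close>

definition coin_bias :: "nat \<Rightarrow> real \<Rightarrow> real" where
  "coin_bias n r = min 1 (real n / (2 * real n - 1) * (1 / r))"

text \<open>
  The value at \<open>0\<close> is junk.  The guard \<open>1 \<le> d i\<close> is there only for termination; see
  \<open>avail_q_Suc\<close> below for the recursion with positive delays.
\<close>

fun avail_q :: "('a \<Rightarrow> nat) \<Rightarrow> ('a \<Rightarrow> 'c::finite \<Rightarrow> real) \<Rightarrow> 'a \<Rightarrow> nat \<Rightarrow> real" where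
  "avail_q d z i 0 = 1"
| "avail_q d z i (Suc 0) = 1"
| "avail_q d z i (Suc (Suc n)) =
     avail_q d z i (Suc n) * (1 - coin_bias (d i) (avail_q d z i (Suc n)) * (\<Sum>j\<in>UNIV. z i j)) +
     (if 1 \<le> d i \<and> d i \<le> Suc n
      then avail_q d z i (Suc n - d i + 1) *
           coin_bias (d i) (avail_q d z i (Suc n - d i + 1)) * (\<Sum>j\<in>UNIV. z i j)
      else 0)"

definition beta :: "('a \<Rightarrow> nat) \<Rightarrow> ('a \<Rightarrow> 'c::finite \<Rightarrow> real) \<Rightarrow> 'a \<Rightarrow> nat \<Rightarrow> real" where
  "beta d z i t = coin_bias (d i) (avail_q d z i t)"

lemma avail_q_Suc:
  assumes "1 \<le> d i" "1 \<le> t"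
  shows "avail_q d z i (t + 1) =
           avail_q d z i t * (1 - beta d z i t * (\<Sum>j\<in>UNIV. z i j)) +
           of_bool (t \<ge> d i) * avail_q d z i (t - d i + 1) * beta d z i (t - d i + 1) *
             (\<Sum>j\<in>UNIV. z i j)"
  using assms by (cases t) (auto simp: beta_def)

definition sample_arm ::
  "'c pmf \<Rightarrow> ('a::finite \<Rightarrow> 'c \<Rightarrow> real) \<Rightarrow> 'c \<Rightarrow> 'a option pmf" where
  "sample_arm f z j = embed_pmf (\<lambda>x. case x of
       None \<Rightarrow> 1 - (\<Sum>i\<in>UNIV. z i j / pmf f j)
     | Some i \<Rightarrow> z i j / pmf f j)"

lemma pmf_sample_arm:
  assumes "lp_feasible f d z" "pmf f j > 0"
  shows "pmf (sample_arm f z j) (Some i) = z i j / pmf f j"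
    and "pmf (sample_arm f z j) None = 1 - (\<Sum>i\<in>UNIV. z i j / pmf f j)"
proof -
  let ?g = "\<lambda>x. case x of None \<Rightarrow> 1 - (\<Sum>i\<in>UNIV. z i j / pmf f j) | Some i \<Rightarrow> z i j / pmf f j"
  have le: "(\<Sum>i\<in>UNIV. z i j / pmf f j) \<le> 1"
    using assms by (simp add: lp_feasible_def flip: sum_divide_distrib)
  have nn: "0 \<le> ?g x" for x
    using assms le by (auto simp: lp_feasible_def split: option.split)
  have "(\<Sum>x\<in>UNIV. ?g x) = 1"
    by (simp add: UNIV_option_conv sum.reindex)
  hence "(\<Sum>x\<in>UNIV. ennreal (?g x)) = 1"
    using nn by (subst sum_ennreal) (simp_all only: ennreal_1)
  hence int: "(\<integral>\<^sup>+x. ennreal (?g x) \<partial>count_space UNIV) = 1"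
    by (simp add: nn_integral_count_space_finite)
  show "pmf (sample_arm f z j) (Some i) = z i j / pmf f j"
    and "pmf (sample_arm f z j) None = 1 - (\<Sum>i\<in>UNIV. z i j / pmf f j)"
    unfolding sample_arm_def using pmf_embed_pmf[of ?g, OF nn int] by simp_all
qed

text \<open>Law of the play in round \<open>t\<close> under context \<open>j\<close>, where \<open>A\<close> records the plays of the earlier rounds.\<close>

definition fi_cbb_round ::
  "'c::finite pmf \<Rightarrow> ('a::finite \<Rightarrow> nat) \<Rightarrow> ('a \<Rightarrow> 'c \<Rightarrow> real) \<Rightarrow> (nat \<Rightarrow> 'a option) \<Rightarrow> nat \<Rightarrow> 'c \<Rightarrow>
   'a option pmf" where
  "fi_cbb_round f d z A t j =
     bind_pmf (sample_arm f z j) (\<lambda>x. case x of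
         None \<Rightarrow> return_pmf None
       | Some i \<Rightarrow>
           if available d A i t
           then map_pmf (\<lambda>b. if b then Some i else None) (bernoulli_pmf (beta d z i t))
           else return_pmf None)"

primrec fi_cbb_plays ::
  "'c::finite pmf \<Rightarrow> ('a::finite \<Rightarrow> nat) \<Rightarrow> ('a \<Rightarrow> 'c \<Rightarrow> real) \<Rightarrow> (nat \<Rightarrow> 'c) \<Rightarrow> nat \<Rightarrow>
   (nat \<Rightarrow> 'a option) pmf" where
  "fi_cbb_plays f d z c 0 = return_pmf (\<lambda>_. None)"
| "fi_cbb_plays f d z c (Suc t) =
     bind_pmf (fi_cbb_plays f d z c t) (\<lambda>A.
     map_pmf (\<lambda>a. A(Suc t := a)) (fi_cbb_round f d z A (Suc t) (c (Suc t))))"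

definition fi_cbb ::
  "'c::finite pmf \<Rightarrow> ('a::finite \<Rightarrow> nat) \<Rightarrow> ('a \<Rightarrow> 'c \<Rightarrow> real) \<Rightarrow> nat \<Rightarrow>
   ((nat \<Rightarrow> 'c) \<times> (nat \<Rightarrow> 'a option)) pmf" where
  "fi_cbb f d z T =
     bind_pmf (context_law f T) (\<lambda>c. map_pmf (\<lambda>A. (c, A)) (fi_cbb_plays f d z c T))"

end

theory Submission imports Defs begin

text \<open>
  Write \<open>r i = d i / (2 * d i - 1)\<close> and \<open>S i = (\<Sum>j. z i j) \<le> 1 / d i\<close>.  As long as
  \<open>q \<ge> r i\<close> one has \<open>q * \<beta> = r i\<close>, so the recursion telescopes to
  \<open>q = 1 - r i * S i * min (t - 1) (d i - 1)\<close>, which is indeed at least \<open>r i\<close>.  Arm \<open>i\<close> is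
  blocked in round \<open>t\<close> by at most one of the previous \<open>d i - 1\<close> rounds, and availability is
  independent of the current context; hence, by induction on \<open>t\<close>, \<open>q\<close> is the probability that
  the arm is available, and every pair \<open>(i, j)\<close> is played in every round with probability exactly
  \<open>r i * z i j\<close>.  The clairvoyant reward is at most \<open>T + d_max - 1\<close> times the value of the linear
  program, and \<open>r\<close> is decreasing in the delay.
\<close>

section \<open>Expectations: finite supports, product measures and independent contexts\<close>

lemma expectation_bind_pmf_finite:
  fixes h :: "'b \<Rightarrow> real"
  assumes "finite (set_pmf p)" "\<And>x. x \<in> set_pmf p \<Longrightarrow> finite (set_pmf (k x))"
  shows "measure_pmf.expectation (bind_pmf p k) h =
         measure_pmf.expectation p (\<lambda>x. measure_pmf.expectation (k x) h)"
  using assms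
  by (subst pmf_expectation_bind[OF assms(1,2)]) (auto simp: integral_measure_pmf[OF assms(1)])

lemma expectation_of_bool:
  "measure_pmf.expectation p (\<lambda>x. of_bool (Q x)) = measure_pmf.prob p {x. Q x}"
proof -
  have "(\<lambda>x. of_bool (Q x) :: real) = indicator {x. Q x}"
    by (auto simp: indicator_def)
  then show ?thesis by simp
qed

text \<open>Fubini, with the product measure standing for the independence of rewards and plays.
  Finite support makes every \<open>g\<close> integrable.\<close>

lemma integral_pmf_pair_mult:
  fixes g :: "'b \<Rightarrow> real" and Y :: "'w \<Rightarrow> real"
  assumes "finite (set_pmf R)" "prob_space N" "integrable N Y"
  shows "integrable (measure_pmf R \<Otimes>\<^sub>M N) (\<lambda>(x, w). Y w * g x)"
    and "(\<integral>(x, w). Y w * g x \<partial>(measure_pmf R \<Otimes>\<^sub>M N)) =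
         integral\<^sup>L N Y * measure_pmf.expectation R g"
proof -
  interpret N: prob_space N by fact
  interpret pair_sigma_finite "measure_pmf R" N ..
  have [measurable]: "Y \<in> borel_measurable N" "g \<in> borel_measurable (measure_pmf R)"
    using assms(3) by simp_all
  show int: "integrable (measure_pmf R \<Otimes>\<^sub>M N) (\<lambda>(x, w). Y w * g x)"
    using assms by (intro Fubini_integrable)
      (auto simp: abs_mult case_prod_beta intro!: integrable_measure_pmf_finite)
  show "(\<integral>(x, w). Y w * g x \<partial>(measure_pmf R \<Otimes>\<^sub>M N)) =
        integral\<^sup>L N Y * measure_pmf.expectation R g"
    using integral_fst'[OF int] assms(3) by (simp add: mult.commute)
qed

lemma finite_set_context_law: "finite (set_pmf (context_law (f :: 'c::finite pmf) T))"
  by (auto simp: context_law_def set_Pi_pmf intro!: finite_PiE_dflt)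

lemma finite_set_fi_cbb_plays: "finite (set_pmf (fi_cbb_plays f d z c t))"
  by (induction t) auto

text \<open>Since \<open>g\<close> ignores coordinate \<open>t\<close>, drawing that coordinate
  separately from the others factors the expectation. Below, \<open>g\<close> is the availability of
  an arm, decided before round \<open>t\<close>, and \<open>h\<close> carries what depends on the
  current context.\<close>

lemma expectation_context_law_mult:
  fixes f :: "'c::finite pmf" and g :: "(nat \<Rightarrow> 'c) \<Rightarrow> real" and h :: "'c \<Rightarrow> real"
  assumes t: "t \<in> {1..T}" and g: "\<And>c x. g (c(t := x)) = g c"
  shows "measure_pmf.expectation (context_law f T) (\<lambda>c. g c * h (c t)) =
         measure_pmf.expectation (context_law f T) g * measure_pmf.expectation f h"
proof -
  let ?P = "Pi_pmf ({1..T} - {t}) undefined (\<lambda>_. f)"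
  have fin: "finite (set_pmf ?P)"
    by (auto simp: set_Pi_pmf intro!: finite_PiE_dflt)
  have "context_law f T =
      bind_pmf f (\<lambda>x. bind_pmf ?P (\<lambda>c. return_pmf (c(t := x))))"
    using t Pi_pmf_insert'[of "{1..T} - {t}" t "undefined :: 'c" "\<lambda>_. f"]
    by (simp add: context_law_def insert_absorb)
  then have E: "measure_pmf.expectation (context_law f T) k =
      measure_pmf.expectation f (\<lambda>x. measure_pmf.expectation ?P (\<lambda>c. k (c(t := x))))" for k :: "_ \<Rightarrow> real"
    using fin by (simp add: expectation_bind_pmf_finite)
  show ?thesis
    by (simp add: E g)
qed

lemma expectation_context_law_nth:
  fixes h :: "'c \<Rightarrow> real"
  assumes "t \<in> {1..T}"
  shows "measure_pmf.expectation (context_law f T) (\<lambda>c. h (c t)) = measure_pmf.expectation f h"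
proof -
  have "measure_pmf.expectation (context_law f T) (\<lambda>c. h (c t)) =
      measure_pmf.expectation (map_pmf (\<lambda>c. c t) (context_law f T)) h"
    by simp
  also have "map_pmf (\<lambda>c. c t) (context_law f T) = f"
    using assms by (simp add: context_law_def Pi_pmf_component)
  finally show ?thesis .
qed

section \<open>Plays and availability for a fixed context sequence\<close>

text \<open>Here and in \<open>avail_prob\<close> the contexts \<open>c\<close> are held fixed and
  only the randomness of the algorithm is averaged out. For availability in round \<open>t\<close>
  the run stops at \<open>t - 1\<close>, because only earlier plays decide it.\<close>

definition play_prob where
  "play_prob f d z c i t = measure_pmf.prob (fi_cbb_plays f d z c t) {A. A t = Some i}"

definition avail_prob where
  "avail_prob f d z c i t = measure_pmf.prob (fi_cbb_plays f d z c (t - 1)) {A. available d A i t}"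

text \<open>Rounds after \<open>s\<close> overwrite only later entries, so the law of entry
  \<open>s\<close> is settled once round \<open>s\<close> is over.\<close>

lemma map_nth_fi_cbb_plays:
  "s \<le> t \<Longrightarrow> map_pmf (\<lambda>A. A s) (fi_cbb_plays f d z c t) = map_pmf (\<lambda>A. A s) (fi_cbb_plays f d z c s)"
proof (induction t)
  case (Suc t)
  show ?case
  proof (cases "s = Suc t")
    case False
    with Suc have "s \<le> t" by simp
    with Suc show ?thesis
      by (simp add: map_bind_pmf pmf.map_comp o_def map_pmf_const False)
         (simp add: map_pmf_def)
  qed simp
qed simp

lemma prob_fi_cbb_plays:
  assumes "s \<le> t"
  shows "measure_pmf.prob (fi_cbb_plays f d z c t) {A. A s = Some i} = play_prob f d z c i s"
proof -
  have "measure_pmf.prob (fi_cbb_plays f d z c t) {A. A s = Some i} =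
        measure_pmf.prob (map_pmf (\<lambda>A. A s) (fi_cbb_plays f d z c t)) {Some i}" for t
    by (simp add: vimage_def)
  then show ?thesis
    by (simp only: play_prob_def map_nth_fi_cbb_plays[OF assms])
qed

lemma available_fun_upd: "t \<le> s \<Longrightarrow> available d (A(s := a)) i t = available d A i t"
  by (auto simp: available_def)

text \<open>Supplies the hypothesis of \<open>of_bool_available\<close>: a round plays an arm only
  after checking its availability, which no entry from round \<open>s\<close> on can change.\<close>

lemma fi_cbb_plays_feasible:
  assumes "A \<in> set_pmf (fi_cbb_plays f d z c t)" "s \<in> {1..t}" "A s = Some i"
  shows "available d A i s"
  using assms
proof (induction t arbitrary: A)
  case (Suc t)
  then obtain B a where B: "B \<in> set_pmf (fi_cbb_plays f d z c t)"
      "a \<in> set_pmf (fi_cbb_round f d z B (Suc t) (c (Suc t)))" and A: "A = B(Suc t := a)"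
    by auto
  show ?case
  proof (cases "s = Suc t")
    case True
    with B A Suc.prems have "available d B i s"
      by (auto simp: fi_cbb_round_def split: option.splits if_splits)
    then show ?thesis
      unfolding A using True by (subst available_fun_upd) auto
  next
    case False
    with Suc.IH[of B] B A Suc.prems have "available d B i s"
      by simp
    then show ?thesis
      unfolding A using Suc.prems by (subst available_fun_upd) auto
  qed
qed simp

text \<open>The delay forces two plays of the same arm to be \<open>d i\<close> rounds apart, so at most one of the
  last \<open>d i - 1\<close> rounds blocks arm \<open>i\<close>.\<close>

lemma of_bool_available:
  assumes feas: "\<And>s. s \<in> {1..t} \<Longrightarrow> A s = Some i \<Longrightarrow> available d A i s"
  shows "of_bool (available d A i (Suc t)) =
         (1 - (\<Sum>s\<in>{s\<in>{1..t}. Suc t < s + d i}. of_bool (A s = Some i)) :: real)"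
proof (cases "available d A i (Suc t)")
  case True
  then show ?thesis
    by (auto simp: available_def intro!: sum.neutral)
next
  case False
  then obtain s where s: "s \<in> {1..t}" "A s = Some i" "Suc t < s + d i"
    by (fastforce simp: available_def)
  have "s' = s" if "s' \<in> {1..t}" "A s' = Some i" "Suc t < s' + d i" for s'
    using feas[of s] feas[of s'] s that
    by (cases s s' rule: linorder_cases) (fastforce simp: available_def)+
  then have "(\<Sum>s'\<in>{s\<in>{1..t}. Suc t < s + d i}. of_bool (A s' = Some i)) =
      (\<Sum>s'\<in>{s\<in>{1..t}. Suc t < s + d i}. if s' = s then 1 else 0 :: real)"
    using s(2) by (intro sum.cong) auto
  also have "\<dots> = 1"
    using s by simp
  finally show ?thesis
    using False by simp
qed

text \<open>The plays that block the arm exclude each other, so linearity of expectation makes the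
  blocking probability a plain sum, although plays of different rounds are dependent.\<close>

lemma avail_prob_Suc:
  "avail_prob f d z c i (Suc t) =
   1 - (\<Sum>s\<in>{s\<in>{1..t}. Suc t < s + d i}. play_prob f d z c i s)"
proof -
  let ?P = "fi_cbb_plays f d z c t"
  note fin = finite_set_fi_cbb_plays[of f d z c t]
  note * = expectation_of_bool[of ?P, symmetric]
  have "avail_prob f d z c i (Suc t) = measure_pmf.expectation ?P
      (\<lambda>A. 1 - (\<Sum>s\<in>{s\<in>{1..t}. Suc t < s + d i}. of_bool (A s = Some i)))"
    unfolding avail_prob_def * diff_Suc_1
  proof (intro integral_cong_AE)
    \<comment> \<open>Exclusivity holds along feasible runs, so the indicator identity is claimed on
      the support only.\<close>
    show "AE A in ?P. of_bool (available d A i (Suc t)) =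
        (1 - (\<Sum>s\<in>{s\<in>{1..t}. Suc t < s + d i}. of_bool (A s = Some i)) :: real)"
      unfolding AE_measure_pmf_iff
      by (intro ballI of_bool_available) (rule fi_cbb_plays_feasible)
  qed simp_all
  also have "\<dots> = 1 - (\<Sum>s\<in>{s\<in>{1..t}. Suc t < s + d i}. measure_pmf.prob ?P {A. A s = Some i})"
    by (simp add: * integrable_measure_pmf_finite[OF fin] Bochner_Integration.integral_sum
        del: sum_of_bool_eq)
  also have "\<dots> = 1 - (\<Sum>s\<in>{s\<in>{1..t}. Suc t < s + d i}. play_prob f d z c i s)"
    by (simp add: prob_fi_cbb_plays)
  finally show ?thesis .
qed

text \<open>Only the sampled arm can be played, and its coin is independent of the sampling. The
  range of \<open>beta\<close> makes it the true success probability of the coin.\<close>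

lemma pmf_fi_cbb_round:
  assumes "lp_feasible f d z" "pmf f j > 0" "beta d z i t \<in> {0..1}"
  shows "pmf (fi_cbb_round f d z A t j) (Some i) =
         of_bool (available d A i t) * (z i j / pmf f j * beta d z i t)"
proof -
  have "pmf (case x of None \<Rightarrow> return_pmf None
       | Some i \<Rightarrow> if available d A i t
           then map_pmf (\<lambda>b. if b then Some i else None) (bernoulli_pmf (beta d z i t))
           else return_pmf None) (Some i) = 
      of_bool (available d A i t) * beta d z i t * of_bool (x = Some i)" for x
  proof -
    have "(\<lambda>b. if b then Some i else None) -` {Some i} = {True}" by (auto split: if_splits)
    moreover have "(\<lambda>b. if b then Some i' else None) -` {Some i} = {}" if "i' \<noteq> i" for i'
      using that by (auto split: if_splits)
    ultimately show ?thesis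
      using assms(3) by (auto simp: pmf_map pmf_return measure_pmf_single split: option.split)
  qed
  then show ?thesis
    by (simp add: fi_cbb_round_def pmf_bind expectation_of_bool measure_pmf_single
        pmf_sample_arm[OF assms(1,2)])
qed

text \<open>The past enters the round only through availability; the other factors are constants
  once \<open>c\<close> is fixed.\<close>

lemma play_prob_Suc:
  assumes "lp_feasible f d z" "\<And>j. pmf f j > 0" "beta d z i (Suc t) \<in> {0..1}"
  shows "play_prob f d z c i (Suc t) =
    avail_prob f d z c i (Suc t) * (z i (c (Suc t)) / pmf f (c (Suc t)) * beta d z i (Suc t))"
proof -
  have "play_prob f d z c i (Suc t) =
      pmf (map_pmf (\<lambda>A. A (Suc t)) (fi_cbb_plays f d z c (Suc t))) (Some i)"
    by (simp only: play_prob_def pmf_map vimage_def) simp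
  also have "\<dots> = measure_pmf.expectation (fi_cbb_plays f d z c t)
      (\<lambda>A. of_bool (available d A i (Suc t)) *
        (z i (c (Suc t)) / pmf f (c (Suc t)) * beta d z i (Suc t)))"
    using assms by (simp add: map_bind_pmf pmf.map_comp o_def pmf_bind pmf_fi_cbb_round)
  also have "\<dots> = avail_prob f d z c i (Suc t) * (z i (c (Suc t)) / pmf f (c (Suc t)) * beta d z i (Suc t))"
    by (simp add: avail_prob_def expectation_of_bool)
  finally show ?thesis .
qed

lemma fi_cbb_plays_cong:
  "(\<And>s. s \<in> {1..t} \<Longrightarrow> c s = c' s) \<Longrightarrow> fi_cbb_plays f d z c t = fi_cbb_plays f d z c' t"
  by (induction t) auto

section \<open>Closed form of the recursion for \<open>avail_q\<close>\<close>

text \<open>The quantity called \<open>r i\<close> at the outset, as a function of the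
  delay.\<close>

definition cbb_ratio :: "nat \<Rightarrow> real" where
  "cbb_ratio n = real n / (2 * real n - 1)"

text \<open>Each round moves mass \<open>r * S\<close> from available to blocked, and from round
  \<open>d i\<close> on the mass that left \<open>d i - 1\<close> rounds before comes back. So
  \<open>avail_q\<close> falls linearly until round \<open>d i\<close> and then stays
  constant.\<close>

lemma avail_q_eq:
  assumes "lp_feasible f d z" "d i \<ge> 1" "t \<ge> 1"
  shows "avail_q d z i t = 1 - cbb_ratio (d i) * (\<Sum>j\<in>UNIV. z i j) * real (min (t - 1) (d i - 1))" (is "?A t")
    and "avail_q d z i t * beta d z i t = cbb_ratio (d i)" (is "?B t")
    and "beta d z i t \<in> {0..1}" (is "?C t")
proof -
  let ?r = "cbb_ratio (d i)" and ?S = "\<Sum>j\<in>UNIV. z i j"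
  have S: "0 \<le> ?S" "?S \<le> 1 / real (d i)"
    using assms by (auto simp: lp_feasible_def intro: sum_nonneg)
  \<comment> \<open>The second equation is where the constant comes from: in the worst case
    \<open>S = 1 / d i\<close>, after \<open>d i - 1\<close> losses, the closed form drops exactly
    to \<open>r\<close>.\<close>
  have r: "0 < ?r" "1 - ?r * (real (d i - 1) / real (d i)) = ?r"
    using assms(2) by (auto simp: cbb_ratio_def field_simps of_nat_diff)
  \<comment> \<open>The closed form alone keeps \<open>avail_q\<close> above \<open>r\<close>, where
    the minimum in the coin bias is \<open>r / avail_q\<close>; so the induction has to carry only
    \<open>?A\<close>.\<close>
  have BC: "?B t \<and> ?C t" if "?A t" for t
  proof -
    have "?S * real (min (t - 1) (d i - 1)) \<le> 1 / real (d i) * real (d i - 1)"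
      using S by (intro mult_mono) auto
    then have "?r * (?S * real (min (t - 1) (d i - 1))) \<le> ?r * (real (d i - 1) / real (d i))"
      using r(1) by (intro mult_left_mono) auto
    with that r(2) have q: "?r \<le> avail_q d z i t"
      by (simp add: mult.assoc)
    then have "beta d z i t = ?r / avail_q d z i t"
      using r(1) by (simp add: beta_def coin_bias_def flip: cbb_ratio_def)
    with q r(1) show ?thesis
      by simp
  qed
  have "?A t"
    using assms(3)
  \<comment> \<open>Strong induction, since the recursion reaches back to round
    \<open>u - d i + 1\<close>.\<close>
  proof (induction t rule: less_induct)
    case (less t)
    show ?case
    proof (cases "t = 1")
      case False
      with less.prems have "t = (t - 1) + 1" "t - 1 \<ge> 1"
        by auto
      then obtain u where u: "t = u + 1" "u \<ge> 1"
        by blast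
      have Bu: "avail_q d z i u * beta d z i u = ?r" and Au: "?A u"
        using BC[of u] less.IH[of u] u by auto
      have B': "avail_q d z i (u - d i + 1) * beta d z i (u - d i + 1) = ?r" if "d i \<le> u"
        using BC[of "u - d i + 1"] less.IH[of "u - d i + 1"] u that assms(2) by auto
      have "avail_q d z i t = avail_q d z i u - avail_q d z i u * beta d z i u * ?S +
          of_bool (d i \<le> u) * (avail_q d z i (u - d i + 1) * beta d z i (u - d i + 1)) * ?S"
        using avail_q_Suc[of d i u z] assms(2) u(2) u(1) by (simp add: algebra_simps)
      also have "\<dots> = avail_q d z i u - ?r * ?S + of_bool (d i \<le> u) * ?r * ?S"
        using Bu B' by auto
      also have "\<dots> = 1 - ?r * ?S * real (min (t - 1) (d i - 1))"
      \<comment> \<open>Once \<open>d i \<le> u\<close>, loss and return cancel and both minima are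
        saturated; before that nothing returns and the minimum grows by one.\<close>
      proof (cases "d i \<le> u")
        case True
        then have "min (u - 1) (d i - 1) = d i - 1" "min (t - 1) (d i - 1) = d i - 1"
          using u by auto
        with True Au show ?thesis by simp
      next
        case False
        then have "min (u - 1) (d i - 1) = u - 1" "min (t - 1) (d i - 1) = u"
          using u by auto
        with False Au u show ?thesis by (simp add: of_nat_diff algebra_simps)
      qed
      finally show ?thesis .
    qed simp
  qed
  with BC show "?A t" "?B t" "?C t" by auto
qed

section \<open>Averaging over the contexts\<close>

text \<open>Identifies the minimum in the closed form of \<open>avail_q\<close> as the number of
  rounds that can block round \<open>Suc t\<close>, cut off at round 1.\<close>

lemma card_recent_rounds: "card {s \<in> {1..t}. Suc t < s + n} = min t (n - 1)"
proof -
  have "{s \<in> {1..t}. Suc t < s + n} = {max 1 (Suc (Suc t) - n)..<Suc t}"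
    by auto
  then show ?thesis
    by auto
qed

text \<open>The context of round \<open>t\<close> is drawn too late to influence the first
  \<open>t - 1\<close> rounds.\<close>

lemma avail_prob_fun_upd: "avail_prob f d z (c(t := x)) i t = avail_prob f d z c i t"
proof -
  have "fi_cbb_plays f d z (c(t := x)) (t - 1) = fi_cbb_plays f d z c (t - 1)"
    by (intro fi_cbb_plays_cong) auto
  then show ?thesis
    by (simp add: avail_prob_def)
qed

text \<open>For a fixed context sequence availability varies with the earlier contexts; its average
  is \<open>avail_q\<close>, which is what \<open>beta\<close> is designed to compensate.\<close>

lemma expectation_play_prob:
  fixes f :: "'c::finite pmf"
  assumes z: "lp_feasible f d z" and f_pos: "\<And>j. pmf f j > 0" and "d i \<ge> 1" and "t \<in> {1..T}"
  shows "measure_pmf.expectation (context_law f T) (\<lambda>c. play_prob f d z c i t * of_bool (c t = j)) =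
         cbb_ratio (d i) * z i j"
  using assms(4)
proof (induction t arbitrary: j rule: less_induct)
  case (less t)
  let ?E = "measure_pmf.expectation (context_law f T)" and ?S = "\<Sum>j\<in>UNIV. z i j"
  note fin = integrable_measure_pmf_finite[OF finite_set_context_law[of f T]]
  obtain u where u: "t = Suc u"
    using less.prems by (cases t) auto
  \<comment> \<open>Summing the induction hypothesis over all contexts removes the
    indicator.\<close>
  have IH: "?E (\<lambda>c. play_prob f d z c i s) = cbb_ratio (d i) * ?S" if "s \<in> {1..u}" for s
  proof -
    have "(\<Sum>j\<in>UNIV. ?E (\<lambda>c. play_prob f d z c i s * of_bool (c s = j))) =
        ?E (\<lambda>c. play_prob f d z c i s * (\<Sum>j\<in>UNIV. of_bool (c s = j)))"
      by (simp only: sum_distrib_left Bochner_Integration.integral_sum[OF fin])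
    also have "\<dots> = ?E (\<lambda>c. play_prob f d z c i s)"
      by (simp add: of_bool_def)
    finally show ?thesis
      using less.IH less.prems that u by (simp add: sum_distrib_left)
  qed
  have "?E (\<lambda>c. avail_prob f d z c i t) = 1 - (\<Sum>s\<in>{s\<in>{1..u}. Suc u < s + d i}. ?E (\<lambda>c. play_prob f d z c i s))"
    unfolding u avail_prob_Suc by (simp add: fin Bochner_Integration.integral_sum)
  also have "\<dots> = 1 - (\<Sum>s\<in>{s\<in>{1..u}. Suc u < s + d i}. cbb_ratio (d i) * ?S)"
    using IH by simp
  also have "\<dots> = avail_q d z i t"
    using avail_q_eq(1)[OF z assms(3), of t] u by (simp add: card_recent_rounds[simplified])
  finally have avail: "?E (\<lambda>c. avail_prob f d z c i t) = avail_q d z i t" .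

  have "?E (\<lambda>c. play_prob f d z c i t * of_bool (c t = j)) =
      ?E (\<lambda>c. avail_prob f d z c i t * (z i (c t) / pmf f (c t) * beta d z i t * of_bool (c t = j)))"
    using avail_q_eq(3)[OF z assms(3), of t] u
    by (simp add: play_prob_Suc[OF z f_pos] mult.assoc)
  \<comment> \<open>Availability and the current context are independent, so the expectation
    factors.\<close>
  also have "\<dots> = avail_q d z i t *
      measure_pmf.expectation f (\<lambda>x. z i x / pmf f x * beta d z i t * of_bool (x = j))"
    using less.prems by (subst expectation_context_law_mult) (auto simp: avail_prob_fun_upd avail)
  \<comment> \<open>The chance \<open>pmf f j\<close> of drawing \<open>j\<close> cancels the
    denominator of the sampling probability.\<close>
  also have "measure_pmf.expectation f (\<lambda>x. z i x / pmf f x * beta d z i t * of_bool (x = j)) =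
      beta d z i t * z i j"
    using f_pos[of j] by (subst integral_measure_pmf[of "{j}"]) auto
  also have "avail_q d z i t * (beta d z i t * z i j) = cbb_ratio (d i) * z i j"
    using avail_q_eq(2)[OF z assms(3), of t] u by simp
  finally show ?case .
qed

section \<open>Expected reward of FI-CBB\<close>

lemma finite_set_fi_cbb: "finite (set_pmf (fi_cbb f d z T))"
  by (auto simp: fi_cbb_def finite_set_context_law finite_set_fi_cbb_plays)

lemma expectation_fi_cbb:
  fixes f :: "'c::finite pmf" and d :: "'a::finite \<Rightarrow> nat"
  assumes z: "lp_feasible f d z" and "\<And>j. pmf f j > 0" and "d i \<ge> 1" and t: "t \<in> {1..T}"
  shows "measure_pmf.expectation (fi_cbb f d z T) (\<lambda>(c, A). of_bool (A t = Some i \<and> c t = j)) =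
         cbb_ratio (d i) * z i j"
proof -
  have "measure_pmf.expectation (fi_cbb f d z T) (\<lambda>(c, A). of_bool (A t = Some i \<and> c t = j)) =
      measure_pmf.expectation (context_law f T) (\<lambda>c. measure_pmf.expectation (fi_cbb_plays f d z c T)
        (\<lambda>A. of_bool (A t = Some i) * of_bool (c t = j) :: real))"
    by (simp add: fi_cbb_def expectation_bind_pmf_finite finite_set_context_law
        finite_set_fi_cbb_plays of_bool_conj)
  also have "\<dots> = measure_pmf.expectation (context_law f T)
      (\<lambda>c. play_prob f d z c i t * of_bool (c t = j))"
    using t by (simp add: expectation_of_bool prob_fi_cbb_plays)
  finally show ?thesis
    using expectation_play_prob[OF assms] by simp
qed

text \<open>Independence replaces each reward by its mean, and the play rate is the same in all
  rounds, hence the factor \<open>T\<close>.\<close>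

lemma expected_reward_fi_cbb:
  fixes f :: "'c::finite pmf" and d :: "'a::finite \<Rightarrow> nat"
  assumes "lp_feasible f d z" and "\<And>j. pmf f j > 0" and "\<And>i. d i \<ge> 1"
    and N: "prob_space N"
    and X: "\<And>i j t. t \<ge> 1 \<Longrightarrow> integrable N (X i j t)"
    and mean: "\<And>i j t. t \<ge> 1 \<Longrightarrow> (\<integral>w. X i j t w \<partial>N) = \<mu> i j"
  shows "expected_reward N X T (fi_cbb f d z T) =
         real T * (\<Sum>i\<in>UNIV. cbb_ratio (d i) * (\<Sum>j\<in>UNIV. \<mu> i j * z i j))"
proof -
  let ?R = "fi_cbb f d z T"
  let ?g = "\<lambda>t i j (c, A). of_bool (A t = Some i \<and> c t = j) :: real"
  let ?M = "measure_pmf ?R \<Otimes>\<^sub>M N"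
  have int: "integrable ?M (\<lambda>(x, w). X i j t w * ?g t i j x)" if "t \<in> {1..T}" for i j t
    using that by (intro integral_pmf_pair_mult(1)[OF finite_set_fi_cbb N X]) auto
  have eq: "(\<integral>(x, w). X i j t w * ?g t i j x \<partial>?M) = \<mu> i j * (cbb_ratio (d i) * z i j)"
    if "t \<in> {1..T}" for i j t
  proof -
    have "(\<integral>(x, w). X i j t w * ?g t i j x \<partial>?M) =
        (\<integral>w. X i j t w \<partial>N) * measure_pmf.expectation ?R (?g t i j)"
      using that by (intro integral_pmf_pair_mult(2)[OF finite_set_fi_cbb N X]) auto
    then show ?thesis
      using that by (simp only: expectation_fi_cbb[OF assms(1-3) that] mean atLeastAtMost_iff)
  qed
  have "expected_reward N X T ?R =
      (\<integral>p. (\<Sum>t=1..T. \<Sum>i\<in>UNIV. \<Sum>j\<in>UNIV. (\<lambda>(x, w). X i j t w * ?g t i j x) p) \<partial>?M)"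
    unfolding expected_reward_def by (simp only: case_prod_unfold)
  also have "\<dots> = (\<Sum>t=1..T. \<Sum>i\<in>UNIV. \<Sum>j\<in>UNIV. \<integral>p. (\<lambda>(x, w). X i j t w * ?g t i j x) p \<partial>?M)"
    by (simp only: Bochner_Integration.integral_sum Bochner_Integration.integrable_sum int cong: sum.cong)
  also have "\<dots> = (\<Sum>t=1..T. \<Sum>i\<in>UNIV. \<Sum>j\<in>UNIV. \<mu> i j * (cbb_ratio (d i) * z i j))"
    by (intro sum.cong refl eq)
  also have "\<dots> = real T * (\<Sum>i\<in>UNIV. cbb_ratio (d i) * (\<Sum>j\<in>UNIV. \<mu> i j * z i j))"
    by (simp add: sum_distrib_left mult_ac)
  finally show ?thesis .
qed

section \<open>Upper bound on the clairvoyant reward\<close>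

text \<open>Packing: the blocks of \<open>d i\<close> rounds opened by the plays are disjoint. The
  last one may stick out of the horizon by \<open>d i - 1\<close> rounds, which is the source of the
  loss for finite \<open>T\<close>.\<close>

lemma card_plays_le:
  assumes A: "A \<in> feasible_schedules d T" and "d i \<ge> 1"
  shows "card {t \<in> {1..T}. A t = Some i} * d i \<le> T + d i - 1"
proof -
  let ?S = "{t \<in> {1..T}. A t = Some i}"
  have sep: "s + d i \<le> t" if "s \<in> ?S" "t \<in> ?S" "s < t" for s t
    using A that by (auto simp: feasible_schedules_def available_def)
  have "card (\<Union>t\<in>?S. {t..<t + d i}) = (\<Sum>t\<in>?S. card {t..<t + d i})"
  proof (intro card_UN_disjoint ballI impI)
    fix s t assume "s \<in> ?S" "t \<in> ?S" "s \<noteq> t"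
    then show "{s..<s + d i} \<inter> {t..<t + d i} = {}"
      using sep[of s t] sep[of t s] by (cases s t rule: linorder_cases) auto
  qed auto
  also have "\<dots> = card ?S * d i"
    by simp
  finally have "card ?S * d i = card (\<Union>t\<in>?S. {t..<t + d i})" ..
  also have "\<dots> \<le> card {1..<T + d i}"
    by (intro card_mono) auto
  finally show ?thesis by simp
qed

text \<open>Together with nonemptiness this makes the \<open>Max\<close> in
  \<open>clairvoyant_reward\<close> an attained maximum.\<close>

lemma finite_feasible_schedules: "finite (feasible_schedules (d :: 'a::finite \<Rightarrow> nat) T)"
  unfolding feasible_schedules_def
  by (rule finite_subset[of _ "{1..T} \<rightarrow>\<^sub>E UNIV"]) (auto intro: finite_PiE)

lemma feasible_schedules_nonempty: "feasible_schedules d T \<noteq> {}"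
proof -
  have "(\<lambda>t\<in>{1..T}. None) \<in> feasible_schedules d T"
    by (auto simp: feasible_schedules_def)
  then show ?thesis by blast
qed

text \<open>The expected play counts of the clairvoyant player, scaled by \<open>1 / (D - 1 + T)\<close>, are feasible
  for the linear program, since arm \<open>i\<close> can be played at most \<open>(T + d i - 1) / d i\<close> times.\<close>

lemma clairvoyant_reward_le:
  fixes f :: "'c::finite pmf" and d :: "'a::finite \<Rightarrow> nat"
  assumes z: "lp_optimal f d \<mu> z" and d: "\<And>i. d i \<ge> 1" "\<And>i. d i \<le> D" and T: "T \<ge> 1"
  shows "clairvoyant_reward f d \<mu> T \<le> (real D - 1 + real T) * lp_value \<mu> z"
proof -
  let ?E = "measure_pmf.expectation (context_law f T)" and ?K = "real D - 1 + real T"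
  note fin = integrable_measure_pmf_finite[OF finite_set_context_law[of f T]]
  have "Max (schedule_value \<mu> T c ` feasible_schedules d T) \<in>
      schedule_value \<mu> T c ` feasible_schedules d T" for c
    by (intro Max_in finite_imageI finite_feasible_schedules) (simp add: feasible_schedules_nonempty)
  then obtain A where A: "A c \<in> feasible_schedules d T"
    "Max (schedule_value \<mu> T c ` feasible_schedules d T) = schedule_value \<mu> T c (A c)" for c
    unfolding image_iff by metis
  \<comment> \<open>Expected number of clairvoyant plays of arm \<open>i\<close> under context
    \<open>j\<close>.\<close>
  define w :: "'a \<Rightarrow> 'c \<Rightarrow> real" where "w i j = ?E (\<lambda>c. \<Sum>t=1..T. of_bool (A c t = Some i \<and> c t = j))" for i j
  \<comment> \<open>\<open>undefined\<close> serves as some arm; its delay witnesses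
    \<open>D \<ge> 1\<close>.\<close>
  have "?K > 0"
    using T of_nat_0_le_iff[of D, where 'a = real] d(1)[of undefined] d(2)[of undefined] by linarith
  \<comment> \<open>The value is linear in the play counts, so the expected optimum is the LP
    objective at \<open>w\<close>.\<close>
  have val: "schedule_value \<mu> T c B =
      (\<Sum>i\<in>UNIV. \<Sum>j\<in>UNIV. \<mu> i j * (\<Sum>t=1..T. of_bool (B t = Some i \<and> c t = j)))" for c B
  proof -
    have "(case B t of None \<Rightarrow> 0 | Some i \<Rightarrow> \<mu> i (c t)) =
        (\<Sum>i\<in>UNIV. \<Sum>j\<in>UNIV. \<mu> i j * of_bool (B t = Some i \<and> c t = j))" for t
    proof -
      have "(\<Sum>j\<in>UNIV. \<mu> i j * of_bool (B t = Some i \<and> c t = j)) =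
          (if B t = Some i then \<mu> i (c t) else 0)" for i
        by (cases "B t = Some i") simp_all
      then show ?thesis
        by (cases "B t") simp_all
    qed
    then have "schedule_value \<mu> T c B =
        (\<Sum>t=1..T. \<Sum>i\<in>UNIV. \<Sum>j\<in>UNIV. \<mu> i j * of_bool (B t = Some i \<and> c t = j))"
      by (simp add: schedule_value_def)
    also have "\<dots> = (\<Sum>i\<in>UNIV. \<Sum>t=1..T. \<Sum>j\<in>UNIV. \<mu> i j * of_bool (B t = Some i \<and> c t = j))"
      by (rule sum.swap)
    also have "\<dots> = (\<Sum>i\<in>UNIV. \<Sum>j\<in>UNIV. \<Sum>t=1..T. \<mu> i j * of_bool (B t = Some i \<and> c t = j))"
      by (intro sum.cong refl sum.swap)
    finally show ?thesis
      by (simp only: sum_distrib_left)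
  qed
  have "clairvoyant_reward f d \<mu> T = (\<Sum>i\<in>UNIV. \<Sum>j\<in>UNIV. \<mu> i j * w i j)"
    unfolding clairvoyant_reward_def A(2) val w_def
    by (simp only: Bochner_Integration.integral_sum fin integral_mult_right_zero)
  also have "\<dots> = ?K * lp_value \<mu> (\<lambda>i j. w i j / ?K)"
    using \<open>?K > 0\<close> by (simp add: lp_value_def sum_distrib_left)
  also have "\<dots> \<le> ?K * lp_value \<mu> z"
  proof (intro mult_left_mono)
    have "lp_feasible f d (\<lambda>i j. w i j / ?K)"
      unfolding lp_feasible_def
    proof (intro conjI allI)
      fix i
      \<comment> \<open>Arm constraint: the packing bound holds for each schedule, so it survives
        averaging although \<open>A c\<close> depends on all of \<open>c\<close>.\<close>
      have "(\<Sum>j\<in>UNIV. w i j) = ?E (\<lambda>c. \<Sum>j\<in>UNIV. \<Sum>t=1..T. of_bool (A c t = Some i \<and> c t = j))"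
        unfolding w_def by (simp only: Bochner_Integration.integral_sum fin)
      also have "\<dots> \<le> ?E (\<lambda>c. ?K / real (d i))"
      proof (intro integral_mono fin)
        fix c
        have "(\<Sum>j\<in>UNIV. \<Sum>t=1..T. of_bool (A c t = Some i \<and> c t = j)) =
            (\<Sum>t=1..T. \<Sum>j\<in>UNIV. of_bool (A c t = Some i \<and> c t = j) :: real)"
          by (rule sum.swap)
        also have "\<dots> = (\<Sum>t=1..T. of_bool (A c t = Some i))"
          by (simp add: of_bool_conj flip: sum_distrib_left)
        also have "\<dots> = real (card {t \<in> {1..T}. A c t = Some i})"
          by (simp add: Int_def)
        also have "\<dots> \<le> ?K / real (d i)"
        proof -
          have "card {t \<in> {1..T}. A c t = Some i} * d i \<le> T + D - 1"
            using card_plays_le[OF A(1) d(1), of c i] d(2)[of i] by linarith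
          then have "real (card {t \<in> {1..T}. A c t = Some i} * d i) \<le> real (T + D - 1)"
            by (simp only: of_nat_le_iff)
          then show ?thesis
            using d[of i] T by (simp add: field_simps of_nat_diff)
        qed
        finally show "(\<Sum>j\<in>UNIV. \<Sum>t=1..T. of_bool (A c t = Some i \<and> c t = j)) \<le> ?K / real (d i)" .
      qed
      finally show "(\<Sum>j\<in>UNIV. w i j / ?K) \<le> 1 / real (d i)"
        using \<open>?K > 0\<close> by (simp add: field_simps flip: sum_divide_distrib)
    next
      fix j
      \<comment> \<open>Context constraint: a round plays at most one arm, so the plays under
        \<open>j\<close> are at most the rounds with context \<open>j\<close>, on average
        \<open>T * pmf f j\<close>; and \<open>T \<le> ?K\<close> because
        \<open>D \<ge> 1\<close>.\<close>
      have "(\<Sum>i\<in>UNIV. w i j) = ?E (\<lambda>c. \<Sum>i\<in>UNIV. \<Sum>t=1..T. of_bool (A c t = Some i \<and> c t = j))"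
        unfolding w_def by (simp only: Bochner_Integration.integral_sum fin)
      also have "\<dots> \<le> ?E (\<lambda>c. \<Sum>t=1..T. of_bool (c t = j))"
      proof (intro integral_mono fin)
        fix c
        have "(\<Sum>i\<in>UNIV. of_bool (A c t = Some i \<and> c t = j)) \<le> (of_bool (c t = j) :: real)" for t
          by (cases "A c t") (auto simp: of_bool_def)
        then show "(\<Sum>i\<in>UNIV. \<Sum>t=1..T. of_bool (A c t = Some i \<and> c t = j)) \<le>
            (\<Sum>t=1..T. of_bool (c t = j) :: real)"
          by (subst sum.swap) (intro sum_mono)
      qed
      also have "\<dots> = (\<Sum>t=1..T. ?E (\<lambda>c. of_bool (c t = j)))"
        by (simp only: Bochner_Integration.integral_sum fin)
      also have "\<dots> = real T * pmf f j"
      proof -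
        have "?E (\<lambda>c. of_bool (c t = j)) = pmf f j" if "t \<in> {1..T}" for t
          unfolding expectation_context_law_nth[OF that, where h = "\<lambda>x. of_bool (x = j)"]
          by (simp add: expectation_of_bool measure_pmf_single)
        then show ?thesis by simp
      qed
      also have "\<dots> \<le> ?K * pmf f j"
        using d[of undefined] by (intro mult_right_mono) auto
      finally show "(\<Sum>i\<in>UNIV. w i j / ?K) \<le> pmf f j"
        using \<open>?K > 0\<close> by (simp add: field_simps flip: sum_divide_distrib)
    next
      fix i j
      show "0 \<le> w i j / ?K"
        using \<open>?K > 0\<close> by (auto simp: w_def intro!: divide_nonneg_pos integral_nonneg sum_nonneg)
    qed
    then show "lp_value \<mu> (\<lambda>i j. w i j / ?K) \<le> lp_value \<mu> z"
      using z by (simp add: lp_optimal_def)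
  qed (use \<open>?K > 0\<close> in simp)
  finally show ?thesis .
qed

section \<open>The worst delay and the competitive ratio\<close>

text \<open>Cross-multiplied, the inequality is just \<open>m \<le> n\<close>. It lets the slowest
  arm determine the guarantee.\<close>

lemma cbb_ratio_antimono:
  assumes "1 \<le> m" "m \<le> n"
  shows "cbb_ratio n \<le> cbb_ratio m"
proof -
  have "real n * (2 * real m - 1) \<le> real m * (2 * real n - 1)"
    using assms by (simp add: right_diff_distrib)
  moreover have "0 < 2 * real m - 1" "0 < 2 * real n - 1"
    using assms by auto
  ultimately show ?thesis
    by (simp add: cbb_ratio_def pos_divide_le_eq pos_le_divide_eq)
qed

theorem theorem1:
  fixes f :: "'c::finite pmf"
    and d :: "'a::finite \<Rightarrow> nat"
    and \<mu> z :: "'a \<Rightarrow> 'c \<Rightarrow> real"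
    and N :: "'w measure"
    and X :: "'a \<Rightarrow> 'c \<Rightarrow> nat \<Rightarrow> 'w \<Rightarrow> real"
    and T :: nat
  defines "d_max \<equiv> real (Max (range d))"
  assumes f_pos: "\<And>j. pmf f j > 0"
    and d_pos: "\<And>i. d i \<ge> 1"
    and N: "prob_space N"
    and X_indep: "\<And>i j. prob_space.indep_vars N (\<lambda>_. borel) (X i j) {1..}"
    and X_ident: "\<And>i j s t. s \<ge> 1 \<Longrightarrow> t \<ge> 1 \<Longrightarrow> distr N borel (X i j s) = distr N borel (X i j t)"
    and X_range: "\<And>i j t. t \<ge> 1 \<Longrightarrow> AE w in N. X i j t w \<in> {0..1}"
    and X_mean: "\<And>i j t. t \<ge> 1 \<Longrightarrow> (\<integral>w. X i j t w \<partial>N) = \<mu> i j"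
    and z_opt: "lp_optimal f d \<mu> z"
    and T_pos: "T \<ge> 1"
  shows "expected_reward N X T (fi_cbb f d z T) \<ge>
           d_max / (2 * d_max - 1) * (1 - (d_max - 1) / (d_max - 1 + real T)) *
             clairvoyant_reward f d \<mu> T"
proof -
  interpret N: prob_space N by fact
  define D where "D = Max (range d)"
  have D: "d i \<le> D" for i
    by (simp add: D_def)
  have D1: "1 \<le> D"
    using D[of undefined] d_pos[of undefined] by simp
  have z: "lp_feasible f d z"
    using z_opt by (simp add: lp_optimal_def)
  have X_int: "integrable N (X i j t)" if "t \<ge> 1" for i j t
  proof (rule N.integrable_const_bound[where B = 1])
    show "AE w in N. norm (X i j t w) \<le> 1"
      using X_range[OF that, of i j] by eventually_elim auto
    \<comment> \<open>Measurability is part of \<open>indep_vars\<close>.\<close>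
    show "X i j t \<in> borel_measurable N"
      using X_indep[of i j] that by (auto simp: N.indep_vars_def)
  qed
  \<comment> \<open>Nonnegative means ensure that lowering each arm's ratio to
    \<open>cbb_ratio D\<close> can only lower the sum.\<close>
  have \<mu>: "0 \<le> \<mu> i j" for i j
  proof -
    have "0 \<le> (\<integral>w. X i j 1 w \<partial>N)"
      using X_range[of 1 i j] by (intro integral_nonneg_AE) auto
    then show ?thesis
      using X_mean[of 1 i j] by simp
  qed
  have K: "real D - 1 + real T > 0"
    using D1 T_pos by simp
  \<comment> \<open>The horizon factor equals \<open>T / (D - 1 + T)\<close>, whose denominator
    cancels the factor in the clairvoyant bound.\<close>
  have "d_max / (2 * d_max - 1) * (1 - (d_max - 1) / (d_max - 1 + real T)) * clairvoyant_reward f d \<mu> T =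
      cbb_ratio D * (real T / (real D - 1 + real T)) * clairvoyant_reward f d \<mu> T"
    using K by (simp add: d_max_def cbb_ratio_def field_simps flip: D_def)
  also have "\<dots> \<le> cbb_ratio D * (real T / (real D - 1 + real T)) *
      ((real D - 1 + real T) * lp_value \<mu> z)"
    using K D1 by (intro mult_left_mono clairvoyant_reward_le[OF z_opt d_pos D T_pos])
      (auto simp: cbb_ratio_def)
  also have "\<dots> = real T * (cbb_ratio D * lp_value \<mu> z)"
    using K by (simp add: field_simps)
  also have "\<dots> = real T * (\<Sum>i\<in>UNIV. cbb_ratio D * (\<Sum>j\<in>UNIV. \<mu> i j * z i j))"
    by (simp add: lp_value_def sum_distrib_left)
  also have "\<dots> \<le> real T * (\<Sum>i\<in>UNIV. cbb_ratio (d i) * (\<Sum>j\<in>UNIV. \<mu> i j * z i j))"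
    using z by (intro mult_left_mono sum_mono mult_right_mono cbb_ratio_antimono d_pos D sum_nonneg)
      (auto simp: lp_feasible_def \<mu>)
  also have "\<dots> = expected_reward N X T (fi_cbb f d z T)"
    using expected_reward_fi_cbb[OF z f_pos d_pos N X_int X_mean] by simp
  finally show ?thesis .
qed

end
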